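(* Let $\mu>0$ and $\lambda\ge 0$. The noncentral chi-square density $\chi_{\mu,\lambda}$ with $\mu$ degrees of freedom and noncentrality $\lambda$ is hyperbolically completely monotone if and only if $\lambda=0$.
   Context: For $\mu>0$ and $\lambda>0$ the noncentral chi-square density is $$\chi_{\mu,\lambda}(x)=\frac12 e^{-(x+\lambda)/2}\left(\frac{x}{\lambda}\right)^{\mu/4-1/2} I_{\mu/2-1}(\sqrt{\lambda x}),\qquad x>0,$$ where $I_\nu$ is the modified Bessel function of the first kind. For $\lambda=0$ it is interpreted as the limit, i.e. the central chi-square density $\chi_{\mu,0}(x)=\frac{(1/2)^{\mu/2}}{\Gamma(\mu/2)}x^{\mu/2-1}e^{-x/2}$, $x>0$. A positive function $f$ on $(0,\infty)$ is hyperbolically completely monotone (HCM) if for every $u>0$ the function $v\mapsto f(uv)f(u/v)$ is completely monotone as a function of $w=v+v^{-1}$ on $(2,\infty)$; that is, for every $u>0$ the function $$H_u(w)=f(u\,v(w))\,f(u/v(w)),\qquad v(w)=\frac{w+\sqrt{w^2-4}}{2},\qquad w>2,$$ has derivatives of all orders on $(2,\infty)$ and satisfies $(-1)^n H_u^{(n)}(w)\ge 0$ for all integers $n\ge 0$ and all $w>2$. *)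

theory Defs
  imports "HOL-Analysis.Analysis"
begin

text \<open>The series for \<^term>\<open>x > 0\<close>; the reciprocal Gamma function vanishes at the nonpositive integers,
  so the formula is also the usual one when \<^term>\<open>\<nu>\<close> is a negative integer.\<close>

definition Bessel_I :: "real \<Rightarrow> real \<Rightarrow> real" where
  "Bessel_I \<nu> x =
     (\<Sum>k. rGamma (real k + \<nu> + 1) / fact k * (x / 2) powr (2 * real k + \<nu>))"

text \<open>At \<^term>\<open>lam = 0\<close> the noncentral formula degenerates, and the density is its limit
  as \<^term>\<open>lam\<close> decreases to \<^term>\<open>0\<close>.\<close>

definition chi_square_density :: "real \<Rightarrow> real \<Rightarrow> real \<Rightarrow> real" where
  "chi_square_density \<mu> lam x =
     (if x \<le> 0 then 0
      else if lam = 0 then (1/2) powr (\<mu>/2) / Gamma (\<mu>/2) * x powr (\<mu>/2 - 1) * exp (- x / 2)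
      else 1/2 * exp (- (x + lam) / 2) * (x / lam) powr (\<mu>/4 - 1/2) * Bessel_I (\<mu>/2 - 1) (sqrt (lam * x)))"

text \<open>Meant for open \<^term>\<open>S\<close>, where the iterated \<^const>\<open>deriv\<close> depends only on
  the values of \<^term>\<open>g\<close> on \<^term>\<open>S\<close>.\<close>

definition completely_monotone_on :: "real set \<Rightarrow> (real \<Rightarrow> real) \<Rightarrow> bool" where
  "completely_monotone_on S g \<longleftrightarrow>
     (\<forall>n. \<forall>x\<in>S. (deriv ^^ n) g field_differentiable (at x) \<and> (-1) ^ n * (deriv ^^ n) g x \<ge> 0)"

text \<open>The root \<open>v > 1\<close> of \<open>v + 1/v = w\<close>, for \<^term>\<open>w > 2\<close>.\<close>

definition hyp_root :: "real \<Rightarrow> real" where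
  "hyp_root w = (w + sqrt (w\<^sup>2 - 4)) / 2"

definition hyperbolically_completely_monotone :: "(real \<Rightarrow> real) \<Rightarrow> bool" where
  "hyperbolically_completely_monotone f \<longleftrightarrow>
     (\<forall>x>0. f x > 0) \<and>
     (\<forall>u>0. completely_monotone_on {2<..} (\<lambda>w. f (u * hyp_root w) * f (u / hyp_root w)))"

end

theory Submission
  imports Defs
begin

text \<open>Put \<open>a = \<mu>/2\<close> and let \<open>h\<^sub>a(z) = \<Sum>k. z ^ k / (k! \<Gamma>(k + a))\<close>, so that the density is proportional
  to \<open>x powr (a - 1) * exp (-x/2) * h\<^sub>a(lam x/4)\<close>. If it is hyperbolically completely monotone, then,
  substituting \<open>w = x/u\<close> and letting \<open>u\<close> tend to \<open>0\<close>, the function \<open>exp (-x/2) * h\<^sub>a(lam x/4)\<close> is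
  a pointwise limit of completely monotone functions, up to positive factors. Finite differences
  survive the limit, so the Taylor coefficients of this entire function at \<open>0\<close> alternate in sign
  and it is positive on the negative axis. Hence \<open>h\<^sub>a(-t) > 0\<close> for all \<open>t \<ge> 0\<close>, that is,
  the Bessel function \<open>J\<close> of order \<open>a - 1\<close> has no positive zero. This is absurd: positivity is
  inherited by \<open>h\<^sub>a\<^sub>+\<^sub>1\<close>, \<open>h\<^sub>a\<^sub>+\<^sub>2\<close>, \<open>h\<^sub>a\<^sub>+\<^sub>3\<close>, and then the recurrence
  \<open>h\<^sub>a(z) = a h\<^sub>a\<^sub>+\<^sub>1(z) + z h\<^sub>a\<^sub>+\<^sub>2(z)\<close> forces \<open>t < a (a + 1)\<close>.\<close>

subsection \<open>Finite differences\<close>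

text \<open>The sign is opposite to that of the usual forward difference, so that all iterates are
  nonnegative on completely monotone functions.\<close>

definition bdiff :: "real \<Rightarrow> (real \<Rightarrow> real) \<Rightarrow> real \<Rightarrow> real" where
  "bdiff d f x = f x - f (x + d)"

text \<open>Induction on \<open>n\<close>: the differenced family is again a chain of derivatives,
  on an interval shorter by \<open>d\<close>, and one ordinary mean value step removes the last
  difference.\<close>

lemma bdiff_funpow_mean_value:
  fixes D :: "nat \<Rightarrow> real \<Rightarrow> real"
  assumes "d > 0"
    and "\<And>k y. k < n \<Longrightarrow> x \<le> y \<Longrightarrow> y \<le> x + n * d \<Longrightarrow> (D k has_real_derivative D (Suc k) y) (at y)"
  shows "\<exists>y. x \<le> y \<and> y \<le> x + n * d \<and> (bdiff d ^^ n) (D 0) x = (- d) ^ n * D n y"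
  using assms(2)
proof (induction n arbitrary: D)
  case 0
  then show ?case by (auto intro!: exI[of _ x])
next
  case (Suc n)
  define E where "E = (\<lambda>k. bdiff d (D k))"
  have "\<exists>y. x \<le> y \<and> y \<le> x + n * d \<and> (bdiff d ^^ n) (E 0) x = (- d) ^ n * E n y"
  proof (rule Suc.IH)
    fix k y assume k: "k < n" and y: "x \<le> y" "y \<le> x + n * d"
    have 1: "(D k has_real_derivative D (Suc k) y) (at y)"
      using k y \<open>d > 0\<close> by (intro Suc.prems) (auto simp: algebra_simps)
    have "(D k has_real_derivative D (Suc k) (y + d)) (at (y + d))"
      using k y \<open>d > 0\<close> by (intro Suc.prems) (auto simp: algebra_simps)
    then have 2: "((\<lambda>t. D k (t + d)) has_real_derivative D (Suc k) (y + d)) (at y)"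
      by (simp add: DERIV_shift)
    show "(E k has_real_derivative E (Suc k) y) (at y)"
      unfolding E_def bdiff_def using 1 2 by (intro DERIV_diff)
  qed
  then obtain y where y: "x \<le> y" "y \<le> x + n * d"
    and eq: "(bdiff d ^^ n) (E 0) x = (- d) ^ n * E n y" by blast
  have "\<exists>z. y < z \<and> z < y + d \<and> D n (y + d) - D n y = (y + d - y) * D (Suc n) z"
    using y \<open>d > 0\<close> by (intro MVT2 Suc.prems) (auto simp: algebra_simps)
  then obtain z where z: "y < z" "z < y + d" "D n (y + d) - D n y = d * D (Suc n) z" by auto
  have "(bdiff d ^^ Suc n) (D 0) x = (- d) ^ n * E n y"
    using eq by (simp add: funpow_swap1 E_def)
  also have "E n y = - d * D (Suc n) z" using z(3) by (simp add: E_def bdiff_def)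
  finally have "(bdiff d ^^ Suc n) (D 0) x = (- d) ^ Suc n * D (Suc n) z" by simp
  with y z show ?case by (intro exI[of _ z]) (auto simp: algebra_simps)
qed

text \<open>An iterated difference combines finitely many values at the points
  \<open>x + k * d\<close>, so pointwise convergence suffices and no convergence of derivatives
  enters.\<close>

lemma tendsto_bdiff_funpow:
  assumes "d > 0" and "\<And>y. y > 0 \<Longrightarrow> ((\<lambda>u. K u y) \<longlongrightarrow> L y) F" and "x > 0"
  shows "((\<lambda>u. (bdiff d ^^ n) (K u) x) \<longlongrightarrow> (bdiff d ^^ n) L x) F"
  using \<open>x > 0\<close>
proof (induction n arbitrary: x)
  case 0
  then show ?case using assms(2) by simp
next
  case (Suc n)
  have "x + d > 0" using Suc.prems assms(1) by simp
  then show ?case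
    using Suc.IH[OF Suc.prems] Suc.IH[of "x + d"] by (simp add: bdiff_def tendsto_diff)
qed

text \<open>The mean value form reduces this to the sign of a derivative of \<open>H\<close>. The
  bound \<open>x > 2 * u\<close> keeps \<open>y / u\<close> in \<open>{2<..}\<close> for all
  \<open>y \<ge> x\<close>, and rescaling only contributes positive factors.\<close>

lemma completely_monotone_on_bdiff_nonneg:
  assumes cm: "completely_monotone_on {2<..} H" and "u > 0" "M > 0" "d > 0" "x > 2 * u"
  shows "(bdiff d ^^ n) (\<lambda>y. H (y / u) / M) x \<ge> 0"
proof -
  define D where "D = (\<lambda>k y. (deriv ^^ k) H (y / u) / (M * u ^ k))"
  have *: "(D k has_real_derivative D (Suc k) y) (at y)" if "y \<ge> x" for k y
  proof -
    have "y / u \<in> {2<..}" using assms that by (simp add: field_simps)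
    then have "(deriv ^^ k) H field_differentiable at (y / u)"
      using cm by (auto simp: completely_monotone_on_def)
    then have "((deriv ^^ k) H has_real_derivative (deriv ^^ Suc k) H (y / u)) (at (y / u))"
      by (simp add: DERIV_deriv_iff_field_differentiable)
    moreover have "((\<lambda>y. y / u) has_real_derivative 1 / u) (at y)"
      using assms by (auto intro!: derivative_eq_intros)
    ultimately have "((\<lambda>y. (deriv ^^ k) H (y / u)) has_real_derivative
        (deriv ^^ Suc k) H (y / u) * (1 / u)) (at y)"
      by (rule DERIV_chain2)
    from DERIV_cdivide[OF this, of "M * u ^ k"] show ?thesis
      by (simp add: D_def mult_ac)
  qed
  have "\<exists>y. x \<le> y \<and> y \<le> x + n * d \<and> (bdiff d ^^ n) (D 0) x = (- d) ^ n * D n y"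
    using * \<open>d > 0\<close> by (intro bdiff_funpow_mean_value) auto
  then obtain y where y: "x \<le> y" "(bdiff d ^^ n) (D 0) x = (- d) ^ n * D n y" by blast
  have "y / u \<in> {2<..}" using assms y by (simp add: field_simps)
  then have "(-1) ^ n * (deriv ^^ n) H (y / u) \<ge> 0"
    using cm by (auto simp: completely_monotone_on_def)
  then have "d ^ n * ((-1) ^ n * (deriv ^^ n) H (y / u)) / (M * u ^ n) \<ge> 0"
    using assms by (intro divide_nonneg_pos mult_nonneg_nonneg[of "d ^ n"]) auto
  also have "\<dots> = (bdiff d ^^ n) (D 0) x"
    unfolding y(2) power_minus[of d] by (simp add: D_def mult_ac)
  finally show ?thesis by (simp add: D_def)
qed

subsection \<open>Entire functions with alternating differences\<close>

lemma summable_diffs_funpow: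
  fixes q :: "nat \<Rightarrow> real"
  assumes "\<And>x. summable (\<lambda>n. q n * x ^ n)"
  shows "summable (\<lambda>n. (diffs ^^ k) q n * x ^ n)"
proof (induction k arbitrary: x)
  case 0
  then show ?case using assms by simp
next
  case (Suc k)
  then show ?case using termdiff_converges_all[of "(diffs ^^ k) q" x] by simp
qed

lemma diffs_funpow_0:
  fixes q :: "nat \<Rightarrow> real"
  shows "(diffs ^^ k) q 0 = fact k * q k"
proof -
  \<comment> \<open>Generalised over the index \<open>n\<close>, because each \<open>diffs\<close>
    shifts it by one.\<close>
  have "(diffs ^^ k) q n = fact (n + k) / fact n * q (n + k)" for n
  proof (induction k arbitrary: n)
    case (Suc k)
    have "(fact (Suc n) :: real) = real (Suc n) * fact n" by simp
    then show ?case using Suc.IH[of "Suc n"]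
      by (simp add: diffs_def add_ac del: fact_Suc of_nat_Suc)
  qed simp
  then show ?thesis by simp
qed

text \<open>A wrong sign of \<open>q n\<close> would be, by continuity, a wrong sign of the
  \<open>n\<close>-th derivative near 0, which differences with a small step detect.\<close>

lemma alternating_coeffs_of_bdiff_nonneg:
  fixes q :: "nat \<Rightarrow> real"
  assumes summ: "\<And>x. summable (\<lambda>n. q n * x ^ n)"
    and nonneg: "\<And>d x n. d > 0 \<Longrightarrow> x > 0 \<Longrightarrow> (bdiff d ^^ n) (\<lambda>x. \<Sum>n. q n * x ^ n) x \<ge> 0"
  shows "(-1) ^ n * q n \<ge> 0"
proof (rule ccontr)
  assume neg: "\<not> (-1) ^ n * q n \<ge> 0"
  define D where "D = (\<lambda>k x. \<Sum>n. (diffs ^^ k) q n * x ^ n)"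
  have der: "(D k has_real_derivative D (Suc k) x) (at x)" for k x
    unfolding D_def using termdiffs_strong_converges_everywhere[of "(diffs ^^ k) q" x]
      summable_diffs_funpow[OF summ] by simp
  have "D n 0 = fact n * q n"
    by (simp add: D_def diffs_funpow_0 powser_zero)
  then have "(-1) ^ n * D n 0 = fact n * ((-1) ^ n * q n)" by (simp add: mult_ac)
  then have neg0: "(-1) ^ n * D n 0 < 0" using neg by (metis fact_gt_zero mult_pos_neg not_le)
  have "isCont (\<lambda>x. (-1) ^ n * D n x) 0"
    by (intro continuous_intros DERIV_isCont[OF der])
  then have "((\<lambda>x. (-1) ^ n * D n x) \<longlongrightarrow> (-1) ^ n * D n 0) (nhds 0)"
    by (simp add: continuous_at isCont_def tendsto_nhds_iff)
  then have "eventually (\<lambda>x. (-1) ^ n * D n x < 0) (nhds 0)"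
    using neg0 by (rule order_tendstoD)
  then obtain e where e: "e > 0" "\<And>x. \<bar>x\<bar> < e \<Longrightarrow> (-1) ^ n * D n x < 0"
    by (auto simp: eventually_nhds_metric dist_real_def)
  \<comment> \<open>The sample points \<open>d\<close>, \<open>2 * d\<close>, ...,
    \<open>(n + 1) * d = e / 2\<close> stay below \<open>e\<close>. They start at \<open>d\<close>
    and not at 0, since the differences are controlled only for \<open>x > 0\<close>.\<close>
  define d where "d = e / (2 * (n + 1))"
  have d: "d > 0" using e by (simp add: d_def)
  have "d * (2 * (n + 1)) = e" by (simp add: d_def)
  then have "d + n * d = e / 2" by (simp add: algebra_simps)
  obtain y where y: "d \<le> y" "y \<le> d + n * d" "(bdiff d ^^ n) (D 0) d = (- d) ^ n * D n y"
    using bdiff_funpow_mean_value[of d n d D] der d by blast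
  have "(-1) ^ n * D n y < 0" using e y d \<open>d + n * d = e / 2\<close> by auto
  then have "d ^ n * ((-1) ^ n * D n y) < 0" using d by (simp add: mult_less_0_iff)
  then have "(bdiff d ^^ n) (D 0) d < 0"
    by (simp add: y power_minus[of d] mult_ac)
  moreover have "(bdiff d ^^ n) (D 0) d \<ge> 0"
    using nonneg[OF d d] by (simp add: D_def)
  ultimately show False by simp
qed

text \<open>At \<open>- t\<close> the two alternations of sign cancel, so no term of the series is
  negative.\<close>

lemma powser_neg_ge_coeff_0:
  fixes q :: "nat \<Rightarrow> real"
  assumes summ: "\<And>x. summable (\<lambda>n. q n * x ^ n)" and alt: "\<And>n. (-1) ^ n * q n \<ge> 0"
    and "t \<ge> 0"
  shows "(\<Sum>n. q n * (- t) ^ n) \<ge> q 0"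
proof -
  have "q n * (- t) ^ n \<ge> 0" for n
  proof -
    have "((-1) ^ n * q n) * t ^ n \<ge> 0" using alt \<open>t \<ge> 0\<close> by simp
    then show ?thesis by (simp add: power_minus[of t] mult_ac)
  qed
  then have "sum (\<lambda>n. q n * (- t) ^ n) {0} \<le> (\<Sum>n. q n * (- t) ^ n)"
    by (intro sum_le_suminf summ) auto
  then show ?thesis by simp
qed

subsection \<open>The series of the Bessel functions\<close>

definition hcoeff :: "real \<Rightarrow> nat \<Rightarrow> real" where
  "hcoeff a k = rGamma (real k + a) / fact k"

text \<open>For \<open>t > 0\<close>, \<open>t powr ((a - 1) / 2)\<close> times
  \<open>hseries a t\<close> is the modified Bessel function I of order \<open>a - 1\<close> at
  \<open>2 * sqrt t\<close>; with \<open>hseries a (- t)\<close> it is J instead.\<close>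

definition hseries :: "real \<Rightarrow> real \<Rightarrow> real" where
  "hseries a z = (\<Sum>k. hcoeff a k * z ^ k)"

lemma hcoeff_pos: "a > 0 \<Longrightarrow> hcoeff a k > 0"
  by (simp add: hcoeff_def rGamma_inverse_Gamma Gamma_real_pos)

lemma hcoeff_Suc:
  assumes "a > 0"
  shows "(real k + 1) * (real k + a) * hcoeff a (Suc k) = hcoeff a k"
proof -
  have "(real k + a) * rGamma (real k + a + 1) = rGamma (real k + a)"
    by (rule rGamma_plus1)
  then show ?thesis by (simp add: hcoeff_def add_ac)
qed

text \<open>Absolute convergence is what the Cauchy product with the exponential series
  requires.\<close>

lemma summable_hcoeff:
  assumes "a > 0"
  shows "summable (\<lambda>k. norm (hcoeff a k * z ^ k))"
proof (rule summable_ratio_test)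
  show "1 / 2 < (1 :: real)" by simp
  \<comment> \<open>From this index on, the ratio \<open>\<bar>z\<bar> / ((k + 1) * (k + a))\<close>
    of consecutive terms is at most 1/2.\<close>
  fix k assume "k \<ge> nat \<lceil>2 * \<bar>z\<bar>\<rceil> + 1"
  then have k: "2 * \<bar>z\<bar> \<le> real k" "real k \<ge> 1" by linarith+
  have "2 * \<bar>z\<bar> \<le> (real k + 1) * (real k + a)"
  proof -
    have "real k * 1 \<le> (real k + 1) * (real k + a)"
      using k assms by (intro mult_mono) auto
    with k show ?thesis by simp
  qed
  then have "hcoeff a (Suc k) * \<bar>z\<bar> ^ k * (2 * \<bar>z\<bar>) \<le>
      hcoeff a (Suc k) * \<bar>z\<bar> ^ k * ((real k + 1) * (real k + a))"
    using hcoeff_pos[OF assms, of "Suc k"] by (intro mult_left_mono) auto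
  also have "\<dots> = hcoeff a k * \<bar>z\<bar> ^ k"
    by (subst hcoeff_Suc[OF assms, of k, symmetric]) (simp add: mult_ac)
  finally have "hcoeff a (Suc k) * \<bar>z\<bar> ^ Suc k \<le> 1 / 2 * (hcoeff a k * \<bar>z\<bar> ^ k)"
    by (simp add: mult_ac)
  then show "norm (norm (hcoeff a (Suc k) * z ^ Suc k)) \<le> 1 / 2 * norm (norm (hcoeff a k * z ^ k))"
    using hcoeff_pos[OF assms, of "Suc k"] hcoeff_pos[OF assms, of k]
    by (simp add: abs_mult power_abs)
qed

lemma hseries_sums: "a > 0 \<Longrightarrow> (\<lambda>k. hcoeff a k * z ^ k) sums hseries a z"
  unfolding hseries_def by (rule summable_sums[OF summable_norm_cancel[OF summable_hcoeff]])

lemma hseries_0: "hseries a 0 = rGamma a"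
  using powser_zero[of "hcoeff a"] by (simp add: hseries_def hcoeff_def)

lemma hseries_pos:
  assumes "a > 0" "z \<ge> 0"
  shows "hseries a z > 0"
proof -
  have "sum (\<lambda>k. hcoeff a k * z ^ k) {0} \<le> hseries a z"
    unfolding hseries_def using assms
    by (intro sum_le_suminf sums_summable[OF hseries_sums])
       (auto intro!: mult_nonneg_nonneg less_imp_le[OF hcoeff_pos])
  then show ?thesis using hcoeff_pos[OF \<open>a > 0\<close>, of 0] by simp
qed

lemma DERIV_hseries:
  assumes "a > 0"
  shows "(hseries a has_real_derivative hseries (a + 1) z) (at z)"
proof -
  have "diffs (hcoeff a) = hcoeff (a + 1)"
    by (auto simp: fun_eq_iff diffs_def hcoeff_def add_ac)
  then show ?thesis
    unfolding hseries_def
    using termdiffs_strong_converges_everywhere[of "hcoeff a" z] sums_summable[OF hseries_sums[OF assms]]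
    by simp
qed

text \<open>The three-term Bessel recurrence. Write the coefficient for \<open>a\<close> as
  \<open>(k + a)\<close> times that for \<open>a + 1\<close>: the summand \<open>a\<close> gives the
  first series, and \<open>k\<close> cancels against the factorial and shifts the index.\<close>

lemma hseries_contiguous:
  assumes "a > 0"
  shows "hseries a z = a * hseries (a + 1) z + z * hseries (a + 2) z"
proof -
  define g where "g = (\<lambda>k. real k * hcoeff (a + 1) k * z ^ k)"
  have "(\<lambda>k. z * (hcoeff (a + 2) k * z ^ k)) sums (z * hseries (a + 2) z)"
    using assms by (intro sums_mult hseries_sums) auto
  also have "(\<lambda>k. z * (hcoeff (a + 2) k * z ^ k)) = (\<lambda>k. g (Suc k))"
    by (auto simp: fun_eq_iff g_def hcoeff_def add_ac)
  \<comment> \<open>The shift loses nothing, because \<open>g 0 = 0\<close>.\<close>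
  finally have "g sums (z * hseries (a + 2) z)"
    by (subst (asm) sums_Suc_iff) (simp add: g_def)
  then have "(\<lambda>k. a * (hcoeff (a + 1) k * z ^ k) + g k) sums
      (a * hseries (a + 1) z + z * hseries (a + 2) z)"
    using assms by (intro sums_add sums_mult hseries_sums) auto
  also have "(\<lambda>k. a * (hcoeff (a + 1) k * z ^ k) + g k) = (\<lambda>k. hcoeff a k * z ^ k)"
  proof
    fix k
    have "(real k + a) * rGamma (real k + a + 1) = rGamma (real k + a)"
      by (rule rGamma_plus1)
    then have "(real k + a) * hcoeff (a + 1) k = hcoeff a k"
      by (simp add: hcoeff_def add_ac)
    then show "a * (hcoeff (a + 1) k * z ^ k) + g k = hcoeff a k * z ^ k"
      by (simp add: g_def algebra_simps flip: \<open>_ = hcoeff a k\<close>)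
  qed
  finally show ?thesis using hseries_sums[OF assms] sums_unique2 by blast
qed

text \<open>The derivative of \<open>t powr a * h\<^sub>a\<^sub>+\<^sub>1(-t)\<close> is \<open>t powr (a - 1) * h\<^sub>a(-t)\<close>.\<close>

lemma hseries_neg_pos_Suc:
  assumes "a > 0" and pos: "\<And>t. t > 0 \<Longrightarrow> hseries a (- t) > 0" and "t > 0"
  shows "hseries (a + 1) (- t) > 0"
proof -
  define \<phi> where "\<phi> = (\<lambda>t. t powr a * hseries (a + 1) (- t))"
  have der_h: "((\<lambda>t. hseries (a + 1) (- t)) has_real_derivative - hseries (a + 2) (- s)) (at s)" for s
  proof -
    have "(hseries (a + 1) has_real_derivative hseries (a + 2) (- s)) (at (- s))"
      using DERIV_hseries[of "a + 1" "- s"] assms(1) by (simp add: add_ac)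
    from DERIV_chain'[OF DERIV_minus[OF DERIV_ident] this] show ?thesis by simp
  qed
  \<comment> \<open>Since \<open>0 powr a = 0\<close>, the left side vanishes, and strict increase
    yields positivity at \<open>t\<close>.\<close>
  have "\<phi> 0 < \<phi> t"
  proof (rule DERIV_pos_imp_increasing_open[OF \<open>t > 0\<close>])
    fix s assume s: "0 < s" "s < t"
    have "(\<phi> has_real_derivative
        a * s powr (a - 1) * hseries (a + 1) (- s) + - hseries (a + 2) (- s) * s powr a) (at s)"
      unfolding \<phi>_def using s by (intro DERIV_mult der_h has_real_derivative_powr)
    also have "s powr a = s powr (a - 1) * s"
      using s powr_mult_base[of s "a - 1"] by (simp add: mult_ac)
    also have "a * s powr (a - 1) * hseries (a + 1) (- s) +
        - hseries (a + 2) (- s) * (s powr (a - 1) * s) = s powr (a - 1) * hseries a (- s)"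
      by (subst hseries_contiguous[OF assms(1), of "- s"]) (simp add: algebra_simps)
    finally show "\<exists>y. (\<phi> has_real_derivative y) (at s) \<and> y > 0"
      using pos[OF s(1)] s by auto
  next
    have "continuous_on {0..t} (\<lambda>t. hseries (a + 1) (- t))"
      using der_h by (meson DERIV_isCont continuous_at_imp_continuous_on)
    then show "continuous_on {0..t} \<phi>"
      unfolding \<phi>_def using assms(1)
      by (intro continuous_on_mult continuous_on_powr' continuous_intros) auto
  qed
  then show ?thesis using assms by (simp add: \<phi>_def zero_less_mult_iff)
qed

lemma hseries_neg_nonpos_ex:
  assumes "a > 0"
  shows "\<exists>t>0. hseries a (- t) \<le> 0"
proof (rule ccontr)
  assume "\<not> ?thesis"
  then have pos0: "hseries a (- t) > 0" if "t > 0" for t using that by force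
  have pos1: "hseries (a + 1) (- t) > 0" if "t > 0" for t
    using hseries_neg_pos_Suc[OF _ pos0 that] assms by simp
  have pos2: "hseries (a + 2) (- t) > 0" if "t > 0" for t
    using hseries_neg_pos_Suc[of "a + 1", OF _ pos1 that] assms by (simp add: add_ac)
  have pos3: "hseries (a + 3) (- t) > 0" if "t > 0" for t
    using hseries_neg_pos_Suc[of "a + 2", OF _ pos2 that] assms by (simp add: add_ac)
  \<comment> \<open>At this value the recurrence for \<open>a\<close> makes
    \<open>a * hseries (a + 1) (- t)\<close> larger than \<open>t * hseries (a + 2) (- t)\<close>,
    while the recurrence for \<open>a + 1\<close> makes it smaller.\<close>
  define t where "t = a * (a + 1)"
  have t: "t > 0" using assms by (simp add: t_def)
  have "t * hseries (a + 2) (- t) < a * hseries (a + 1) (- t)"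
    using pos0[OF t] hseries_contiguous[OF assms, of "- t"] by simp
  moreover have "hseries (a + 1) (- t) = (a + 1) * hseries (a + 2) (- t) - t * hseries (a + 3) (- t)"
    using hseries_contiguous[of "a + 1" "- t"] assms by (simp add: add_ac)
  then have "hseries (a + 1) (- t) < (a + 1) * hseries (a + 2) (- t)"
    using mult_pos_pos[OF t pos3[OF t]] by simp
  then have "a * hseries (a + 1) (- t) < a * ((a + 1) * hseries (a + 2) (- t))"
    using assms by (intro mult_strict_left_mono)
  ultimately show False by (simp add: t_def mult_ac)
qed

subsection \<open>The density\<close>

lemma hyp_root:
  assumes "w > 2"
  shows "hyp_root w > 0" "hyp_root w + 1 / hyp_root w = w"
proof -
  have "w\<^sup>2 > 2\<^sup>2" using assms by (intro power_strict_mono) auto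
  then have s: "(sqrt (w\<^sup>2 - 4))\<^sup>2 = w\<^sup>2 - 4" "sqrt (w\<^sup>2 - 4) \<ge> 0" by auto
  show pos: "hyp_root w > 0"
    using add_pos_nonneg[OF _ s(2), of w] assms by (simp add: hyp_root_def)
  have "hyp_root w * hyp_root w + 1 = w * hyp_root w"
    using s(1) by (simp add: hyp_root_def field_simps power2_eq_square)
  then show "hyp_root w + 1 / hyp_root w = w" using pos by (simp add: field_simps)
qed

lemma hyp_root_scaled:
  assumes "u > 0"
  shows "u * hyp_root (x / u) = (x + sqrt (x\<^sup>2 - 4 * u\<^sup>2)) / 2"
proof -
  \<comment> \<open>No sign condition on the radicand arises: \<open>sqrt\<close> is odd and
    multiplicative on all reals.\<close>
  have "u * sqrt ((x / u)\<^sup>2 - 4) = sqrt (u\<^sup>2 * ((x / u)\<^sup>2 - 4))"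
    using assms by (simp add: real_sqrt_mult)
  also have "u\<^sup>2 * ((x / u)\<^sup>2 - 4) = x\<^sup>2 - 4 * u\<^sup>2"
    using assms by (simp add: field_simps)
  finally show ?thesis using assms by (simp add: hyp_root_def field_simps)
qed

text \<open>The two arguments of the density at \<open>w = x / u\<close> have product
  \<open>u\<^sup>2\<close>; the larger tends to \<open>x\<close>, which forces the smaller to
  0.\<close>

lemma tendsto_hyp_root_scaled:
  assumes "x > 0"
  shows "((\<lambda>u. u * hyp_root (x / u)) \<longlongrightarrow> x) (at_right 0)"
    and "((\<lambda>u. u / hyp_root (x / u)) \<longlongrightarrow> 0) (at_right 0)"
proof -
  have "((\<lambda>u. (x + sqrt (x\<^sup>2 - 4 * u\<^sup>2)) / 2) \<longlongrightarrow> (x + sqrt (x\<^sup>2 - 4 * 0\<^sup>2)) / 2) (at_right 0)"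
    by (intro tendsto_intros) auto
  then have "((\<lambda>u. (x + sqrt (x\<^sup>2 - 4 * u\<^sup>2)) / 2) \<longlongrightarrow> x) (at_right 0)"
    using assms by simp
  then show 1: "((\<lambda>u. u * hyp_root (x / u)) \<longlongrightarrow> x) (at_right 0)"
    by (rule Lim_transform_eventually)
       (auto simp: eventually_at_right_field hyp_root_scaled intro!: exI[of _ 1])
  have "((\<lambda>u. u\<^sup>2 / (u * hyp_root (x / u))) \<longlongrightarrow> 0\<^sup>2 / x) (at_right 0)"
    using assms by (intro tendsto_intros 1) auto
  then have "((\<lambda>u. u\<^sup>2 / (u * hyp_root (x / u))) \<longlongrightarrow> 0) (at_right 0)" by simp
  then show "((\<lambda>u. u / hyp_root (x / u)) \<longlongrightarrow> 0) (at_right 0)"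
    by (rule Lim_transform_eventually)
       (auto simp: eventually_at_right_field power2_eq_square intro!: exI[of _ 1])
qed

text \<open>Factoring a power of \<open>lam * x / 4\<close> out of the Bessel series cancels
  \<open>lam\<close> in the prefactor, as \<open>x / lam * (lam * x / 4)\<close> is the square of
  \<open>x / 2\<close>.\<close>

lemma chi_square_density_noncentral:
  assumes "\<mu> > 0" "lam > 0" "x > 0"
  shows "chi_square_density \<mu> lam x =
    1/2 * exp (- lam / 2) * exp (- x / 2) * (x / 2) powr (\<mu>/2 - 1) * hseries (\<mu>/2) (lam * x / 4)"
proof -
  define a where "a = \<mu> / 2"
  define y where "y = lam * x / 4"
  have y: "y > 0" using assms by (simp add: y_def)
  have "sqrt (lam * x) / 2 = sqrt y" by (simp add: y_def real_sqrt_divide)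
  then have s: "sqrt (lam * x) / 2 = y powr (1/2)" using y by (simp add: powr_half_sqrt)
  have "(sqrt (lam * x) / 2) powr (2 * real k + (a - 1)) = y powr ((a - 1) / 2) * y ^ k" for k
  proof -
    have e: "1/2 * (2 * real k + (a - 1)) = (a - 1) / 2 + real k" by (simp add: field_simps)
    show ?thesis unfolding s powr_powr e using y by (simp add: powr_add powr_realpow)
  qed
  then have "Bessel_I (a - 1) (sqrt (lam * x)) =
      (\<Sum>k. y powr ((a - 1) / 2) * (hcoeff a k * y ^ k))"
    by (simp add: Bessel_I_def hcoeff_def mult_ac)
  also have "\<dots> = y powr ((a - 1) / 2) * hseries a y"
    using assms sums_mult[OF hseries_sums[of a y]] by (simp add: a_def sums_iff)
  finally have B: "Bessel_I (a - 1) (sqrt (lam * x)) = y powr ((a - 1) / 2) * hseries a y" .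
  have "(x / lam) powr ((a - 1) / 2) * y powr ((a - 1) / 2) = (x / lam * y) powr ((a - 1) / 2)"
    by (rule powr_mult[symmetric])
  also have "x / lam * y = (x / 2) powr 2"
    using assms by (simp add: y_def power2_eq_square)
  also have "\<dots> powr ((a - 1) / 2) = (x / 2) powr (a - 1)"
    by (simp add: powr_powr diff_divide_distrib)
  finally have P: "(x / lam) powr ((a - 1) / 2) * y powr ((a - 1) / 2) = (x / 2) powr (a - 1)" .
  have e: "\<mu>/4 - 1/2 = (a - 1) / 2" by (simp add: a_def field_simps)
  have "chi_square_density \<mu> lam x = 1/2 * exp (- (x + lam) / 2) *
      ((x / lam) powr ((a - 1) / 2) * y powr ((a - 1) / 2)) * hseries a y"
    using assms B unfolding chi_square_density_def e by (simp add: a_def)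
  also have "exp (- (x + lam) / 2) = exp (- lam / 2) * exp (- x / 2)"
    by (simp add: field_simps flip: exp_add)
  finally show ?thesis unfolding P by (simp add: a_def y_def)
qed

text \<open>Exponentials and powers depend only on the sum \<open>u * w\<close> and the product
  \<open>u\<^sup>2\<close> of the two arguments; only the \<open>hseries\<close> factors see
  \<open>hyp_root w\<close> itself.\<close>

lemma chi_square_density_noncentral_product:
  assumes "\<mu> > 0" "lam > 0" "u > 0" "w > 2"
  shows "chi_square_density \<mu> lam (u * hyp_root w) * chi_square_density \<mu> lam (u / hyp_root w) =
    1/4 * exp (- lam) * (u / 2) powr (\<mu> - 2) *
    (exp (- (u * w) / 2) * hseries (\<mu>/2) (lam * (u * hyp_root w) / 4) *
      hseries (\<mu>/2) (lam * (u / hyp_root w) / 4))"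
proof -
  define v where "v = hyp_root w"
  have v: "v > 0" "v + 1 / v = w" using hyp_root assms by (simp_all add: v_def)
  have e: "exp (- (u * v) / 2) * exp (- (u / v) / 2) = exp (- (u * w) / 2)"
    unfolding v(2)[symmetric] by (simp add: field_simps flip: exp_add)
  have l: "exp (- lam / 2) * exp (- lam / 2) = exp (- lam)"
    by (simp flip: exp_add)
  have "(u * v / 2) powr (\<mu>/2 - 1) * (u / v / 2) powr (\<mu>/2 - 1) =
      (u * v / 2 * (u / v / 2)) powr (\<mu>/2 - 1)"
    by (rule powr_mult[symmetric])
  also have "u * v / 2 * (u / v / 2) = (u / 2) powr 2"
    using assms v by (simp add: power2_eq_square)
  also have "\<dots> powr (\<mu>/2 - 1) = (u / 2) powr (\<mu> - 2)"
    by (simp add: powr_powr)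
  finally have p: "(u * v / 2) powr (\<mu>/2 - 1) * (u / v / 2) powr (\<mu>/2 - 1) = (u / 2) powr (\<mu> - 2)" .
  have "chi_square_density \<mu> lam (u * v) * chi_square_density \<mu> lam (u / v) =
    1/4 * (exp (- lam / 2) * exp (- lam / 2)) *
    ((u * v / 2) powr (\<mu>/2 - 1) * (u / v / 2) powr (\<mu>/2 - 1)) *
    ((exp (- (u * v) / 2) * exp (- (u / v) / 2)) * hseries (\<mu>/2) (lam * (u * v) / 4) *
      hseries (\<mu>/2) (lam * (u / v) / 4))"
    using assms v by (simp add: chi_square_density_noncentral)
  then show ?thesis unfolding e l p by (simp only: v_def)
qed

section \<open>The noncentral case\<close>

lemma noncentral_not_hcm:
  assumes "\<mu> > 0" "lam > 0"
  shows "\<not> hyperbolically_completely_monotone (chi_square_density \<mu> lam)"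
proof
  assume hcm: "hyperbolically_completely_monotone (chi_square_density \<mu> lam)"
  define a where "a = \<mu> / 2"
  define c where "c = lam / 4"
  have a: "a > 0" and c: "c > 0" using assms by (auto simp: a_def c_def)
  define H where "H = (\<lambda>u w. chi_square_density \<mu> lam (u * hyp_root w) *
    chi_square_density \<mu> lam (u / hyp_root w))"
  \<comment> \<open>The prefactor of the product, times the limit
    \<open>hseries a 0 = rGamma a\<close> of the factor whose argument tends to 0.\<close>
  define M where "M = (\<lambda>u. 1/4 * exp (- lam) * (u / 2) powr (\<mu> - 2) * rGamma a)"
  define L where "L = (\<lambda>x. exp (- x / 2) * hseries a (c * x))"
  have rG: "rGamma a > 0" using hseries_pos[OF a, of 0] by (simp add: hseries_0)
  have M_pos: "M u > 0" if "u > 0" for u using that rG by (simp add: M_def)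
  have lim: "((\<lambda>u. H u (x / u) / M u) \<longlongrightarrow> L x) (at_right 0)" if "x > 0" for x
  proof -
    have cont: "isCont (hseries a) z" for z using DERIV_isCont[OF DERIV_hseries[OF a]] .
    have "((\<lambda>u. exp (- x / 2) * hseries a (c * (u * hyp_root (x / u))) *
        hseries a (c * (u / hyp_root (x / u))) / rGamma a) \<longlongrightarrow>
        exp (- x / 2) * hseries a (c * x) * hseries a (c * 0) / rGamma a) (at_right 0)"
      using rG by (intro tendsto_intros isCont_tendsto_compose[OF cont]
          tendsto_hyp_root_scaled that) auto
    also have "exp (- x / 2) * hseries a (c * x) * hseries a (c * 0) / rGamma a = L x"
      using rG by (simp add: hseries_0 L_def)
    finally have 1: "((\<lambda>u. exp (- x / 2) * hseries a (c * (u * hyp_root (x / u))) *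
        hseries a (c * (u / hyp_root (x / u))) / rGamma a) \<longlongrightarrow> L x) (at_right 0)" .
    have "H u (x / u) / M u = exp (- x / 2) * hseries a (c * (u * hyp_root (x / u))) *
        hseries a (c * (u / hyp_root (x / u))) / rGamma a" if u: "u > 0" "u < x / 2" for u
    proof -
      have "x / u > 2" "u * (x / u) = x" using u by (auto simp: field_simps)
      then have "H u (x / u) = M u / rGamma a * (exp (- x / 2) *
          hseries a (c * (u * hyp_root (x / u))) * hseries a (c * (u / hyp_root (x / u))))"
        unfolding H_def
        by (subst chi_square_density_noncentral_product[OF assms u(1)])
           (use rG in \<open>simp_all add: M_def a_def c_def mult_ac\<close>)
      then show ?thesis using M_pos[OF u(1)] rG by (simp add: field_simps)
    qed
    then have "\<forall>\<^sub>F u in at_right 0. exp (- x / 2) * hseries a (c * (u * hyp_root (x / u))) *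
        hseries a (c * (u / hyp_root (x / u))) / rGamma a = H u (x / u) / M u"
      unfolding eventually_at_right_field using that by (intro exI[of _ "x / 2"]) simp
    with 1 show ?thesis by (rule Lim_transform_eventually)
  qed
  have L_diff: "(bdiff d ^^ n) L x \<ge> 0" if "d > 0" "x > 0" for d x n
  proof (rule tendsto_lowerbound)
    show "((\<lambda>u. (bdiff d ^^ n) (\<lambda>x. H u (x / u) / M u) x) \<longlongrightarrow> (bdiff d ^^ n) L x) (at_right 0)"
      using tendsto_bdiff_funpow[OF that(1), of "\<lambda>u x. H u (x / u) / M u" L] lim that by blast
    have "(bdiff d ^^ n) (\<lambda>x. H u (x / u) / M u) x \<ge> 0" if "u > 0" "u < x / 2" for u
      using hcm \<open>d > 0\<close> that M_pos[of u]
      by (intro completely_monotone_on_bdiff_nonneg)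
         (auto simp: hyperbolically_completely_monotone_def H_def)
    then show "\<forall>\<^sub>F u in at_right 0. (bdiff d ^^ n) (\<lambda>x. H u (x / u) / M u) x \<ge> 0"
      using that by (auto simp: eventually_at_right_field intro!: exI[of _ "x / 2"])
  qed simp
  \<comment> \<open>Cauchy product coefficients of \<open>exp (- x / 2)\<close> and
    \<open>hseries a (c * x)\<close>.\<close>
  define q where "q = (\<lambda>n. \<Sum>i\<le>n. (- 1 / 2) ^ i / fact i * (hcoeff a (n - i) * c ^ (n - i)))"
  have q: "(\<lambda>n. q n * x ^ n) sums L x" for x
  proof -
    define A where "A = (\<lambda>i. (- x / 2) ^ i /\<^sub>R fact i)"
    define B where "B = (\<lambda>i. hcoeff a i * (c * x) ^ i)"
    have "(\<lambda>n. \<Sum>i\<le>n. A i * B (n - i)) sums ((\<Sum>i. A i) * (\<Sum>i. B i))"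
      unfolding A_def B_def
      by (intro Cauchy_product_sums summable_norm_exp summable_hcoeff a)
    also have "(\<Sum>i. A i) * (\<Sum>i. B i) = L x"
      by (simp only: A_def B_def L_def hseries_def exp_def)
    also have "(\<lambda>n. \<Sum>i\<le>n. A i * B (n - i)) = (\<lambda>n. q n * x ^ n)"
    proof
      fix n
      have "A i * B (n - i) = (- 1 / 2) ^ i / fact i * (hcoeff a (n - i) * c ^ (n - i)) * x ^ n"
        if "i \<le> n" for i
      proof -
        have "x ^ n = x ^ i * x ^ (n - i)" using that by (simp flip: power_add)
        moreover have "(- x / 2) ^ i = (- 1 / 2) ^ i * x ^ i"
          using power_mult_distrib[of "- 1 / 2" x i] by simp
        ultimately show ?thesis
          unfolding A_def B_def by (simp only: power_mult_distrib) (simp add: field_simps)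
      qed
      then show "(\<Sum>i\<le>n. A i * B (n - i)) = q n * x ^ n"
        unfolding q_def sum_distrib_right by (intro sum.cong) auto
    qed
    finally show ?thesis .
  qed
  have summ: "summable (\<lambda>n. q n * x ^ n)" for x using q sums_summable by blast
  have L_eq: "L = (\<lambda>x. \<Sum>n. q n * x ^ n)" using q by (auto simp: sums_iff)
  have alt: "(-1) ^ n * q n \<ge> 0" for n
    using summ L_diff unfolding L_eq by (rule alternating_coeffs_of_bdiff_nonneg)
  have "q 0 > 0" using rG by (simp add: q_def hcoeff_def)
  then have L_pos: "L (- t) > 0" if "t \<ge> 0" for t
    using powser_neg_ge_coeff_0[OF summ alt that] by (simp add: L_eq)
  obtain t where t: "t > 0" "hseries a (- t) \<le> 0" using hseries_neg_nonpos_ex[OF a] by blast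
  \<comment> \<open>\<open>L (- (t / c))\<close> is a positive exponential times
    \<open>hseries a (- t)\<close>, which is not positive.\<close>
  have "L (- (t / c)) > 0" using t c by (intro L_pos) simp
  then show False using t c by (simp add: L_def zero_less_mult_iff)
qed

section \<open>The central case\<close>

lemma completely_monotone_on_exp:
  assumes "open S" "A \<ge> 0" "b \<ge> 0" and g: "\<And>w. w \<in> S \<Longrightarrow> g w = A * exp (- b * w)"
  shows "completely_monotone_on S g"
proof -
  \<comment> \<open>Only values of \<open>g\<close> on \<open>S\<close> are known; openness of
    \<open>S\<close> carries the formula for one derivative over to the next.\<close>
  have der: "((deriv ^^ n) g has_real_derivative A * (- b) ^ Suc n * exp (- b * w)) (at w)"
    if "w \<in> S" "\<And>w. w \<in> S \<Longrightarrow> (deriv ^^ n) g w = A * (- b) ^ n * exp (- b * w)" for n w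
  proof (rule has_field_derivative_transform_within_open[OF _ \<open>open S\<close> that(1)])
    show "((\<lambda>w. A * (- b) ^ n * exp (- b * w)) has_real_derivative
        A * (- b) ^ Suc n * exp (- b * w)) (at w)"
      by (auto intro!: derivative_eq_intros)
  qed (simp add: that(2))
  have eq: "(deriv ^^ n) g w = A * (- b) ^ n * exp (- b * w)" if "w \<in> S" for n w
    using that
  proof (induction n arbitrary: w)
    case (Suc n)
    then show ?case using DERIV_imp_deriv[OF der[of w n]] by simp
  qed (use g in simp)
  show ?thesis
    unfolding completely_monotone_on_def
  proof (intro allI ballI conjI)
    fix n w assume w: "w \<in> S"
    show "(deriv ^^ n) g field_differentiable at w"
      using der[OF w eq] by (auto simp: field_differentiable_def)
    show "(-1) ^ n * (deriv ^^ n) g w \<ge> 0"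
    proof -
      have "(-1) ^ n * (A * (- b) ^ n * exp (- b * w)) = A * b ^ n * exp (- b * w)"
        unfolding power_minus[of b] by (simp add: mult_ac)
      also have "\<dots> \<ge> 0" using assms by (intro mult_nonneg_nonneg) auto
      finally show ?thesis unfolding eq[OF w] .
    qed
  qed
qed

text \<open>The powers multiply to a constant in \<open>w\<close> and the exponents add up to
  \<open>- (u / 2) * w\<close>, so the product is a decaying exponential.\<close>

lemma central_hcm:
  assumes "\<mu> > 0"
  shows "hyperbolically_completely_monotone (chi_square_density \<mu> 0)"
proof -
  define C where "C = (1/2) powr (\<mu>/2) / Gamma (\<mu>/2)"
  have C: "C > 0" using assms by (simp add: C_def Gamma_real_pos)
  have f: "chi_square_density \<mu> 0 x = C * x powr (\<mu>/2 - 1) * exp (- x / 2)" if "x > 0" for x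
    using that by (simp add: chi_square_density_def C_def)
  show ?thesis
    unfolding hyperbolically_completely_monotone_def
  proof (intro conjI allI impI)
    fix x :: real assume "x > 0"
    then show "chi_square_density \<mu> 0 x > 0" using C by (simp add: f)
  next
    fix u :: real assume u: "u > 0"
    show "completely_monotone_on {2<..}
        (\<lambda>w. chi_square_density \<mu> 0 (u * hyp_root w) * chi_square_density \<mu> 0 (u / hyp_root w))"
    proof (rule completely_monotone_on_exp)
      fix w :: real assume "w \<in> {2<..}"
      then have v: "hyp_root w > 0" "hyp_root w + 1 / hyp_root w = w" using hyp_root by auto
      have e: "exp (- (u * hyp_root w) / 2) * exp (- (u / hyp_root w) / 2) = exp (- (u / 2) * w)"
        \<comment> \<open>The third occurrence of \<open>w\<close> is the bare one; the first two
          lie inside \<open>hyp_root w\<close>.\<close>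
        by (subst (3) v(2)[symmetric]) (simp add: field_simps flip: exp_add)
      have p: "(u * hyp_root w) powr (\<mu>/2 - 1) * (u / hyp_root w) powr (\<mu>/2 - 1) =
          (u\<^sup>2) powr (\<mu>/2 - 1)"
        using u v(1) by (simp add: power2_eq_square flip: powr_mult)
      have "chi_square_density \<mu> 0 (u * hyp_root w) * chi_square_density \<mu> 0 (u / hyp_root w) =
          C\<^sup>2 * ((u * hyp_root w) powr (\<mu>/2 - 1) * (u / hyp_root w) powr (\<mu>/2 - 1)) *
          (exp (- (u * hyp_root w) / 2) * exp (- (u / hyp_root w) / 2))"
        using u v(1) by (simp add: f power2_eq_square mult_ac)
      then show "chi_square_density \<mu> 0 (u * hyp_root w) * chi_square_density \<mu> 0 (u / hyp_root w) =
          C\<^sup>2 * (u\<^sup>2) powr (\<mu>/2 - 1) * exp (- (u / 2) * w)"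
        unfolding e p .
    qed (use u in auto)
  qed
qed

theorem corollary1:
  fixes \<mu> lam :: real
  assumes "\<mu> > 0" and "lam \<ge> 0"
  shows "hyperbolically_completely_monotone (chi_square_density \<mu> lam) \<longleftrightarrow> lam = 0"
  using central_hcm[OF assms(1)] noncentral_not_hcm[OF assms(1), of lam] assms(2) by force

end
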